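(* Let $\mathcal{X}$ be a set of size $n$ and let $\gamma=\gamma(n)\in(0,1)$. Let $b,s\ge 1$ be integers and let $\mathcal{H}=(\mathcal{X},\mathcal{F})$ be a hypergraph with $\mathcal{F}=\mathcal{F}_1\cup\dots\cup\mathcal{F}_s$, each $\mathcal{F}_j$ nonempty, and $|\mathcal{F}|>1$. Let $k_j:=\min_{F\in\mathcal{F}_j}|F|$ for every $j\in[s]$ and assume that $$\left(\frac{k_j}{\ln(s|\mathcal{F}_j|)}\right)^{\gamma/2}\ge 20b\cdot\max\left\{1,\log_{b+1}\left(\frac{k_j}{\ln(s|\mathcal{F}_j|)}\right)\right\}$$ for every $j\in[s]$. Then, in the $(1:b)$ multistage Maker-Breaker game on $\mathcal{H}$, Maker has a strategy to ensure that after $$\left\lfloor(1-\gamma)\min_{i\in[s]}\log_{b+1}\left(\frac{k_i}{\ln(s|\mathcal{F}_i|)}\right)\right\rfloor$$ stages, she still claims at least one element in each $F\in\mathcal{F}$ (i.e. $F\cap\mathcal{X}_t\ne\varnothing$ for all $F\in\mathcal{F}$, where $t$ is this number of stages and $\mathcal{X}_t$ is the set of elements claimed by Maker in Stage $t$, with $\mathcal{X}_0=\mathcal{X}$).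
   Context: $[s]=\{1,\dots,s\}$ and $\ln$ is the natural logarithm. Multistage $(1:b)$ Maker-Breaker game on $\mathcal{H}=(\mathcal{X},\mathcal{F})$: put $\mathcal{X}_0:=\mathcal{X}$. For $i\ge 1$, in Stage $i$ Maker and Breaker play on the board $\mathcal{X}_{i-1}$, alternating in turns in which Maker claims exactly one unclaimed element of $\mathcal{X}_{i-1}$ and afterwards Breaker claims up to $b$ unclaimed elements of $\mathcal{X}_{i-1}$, with Maker moving first. Once all elements of $\mathcal{X}_{i-1}$ have been distributed among the players, $\mathcal{X}_i\subseteq\mathcal{X}_{i-1}$ denotes the set of all elements claimed by Maker in Stage $i$, and this is the board of Stage $i+1$. In this statement the stages are played one after another for the stated number of stages, irrespective of whether any set $F\in\mathcal{F}$ is still fully contained in the current board. *)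

theory Defs
  imports Complex_Main
begin

definition hypergraph :: "'a set \<Rightarrow> 'a set set \<Rightarrow> bool" where
  "hypergraph X F \<longleftrightarrow> finite X \<and> F \<subseteq> Pow X"

(* (x, Y): Maker claims x, afterwards Breaker claims all elements of Y. *)
type_synonym 'a round = "'a \<times> 'a set"

definition maker_claimed :: "'a round list \<Rightarrow> 'a set" where
  "maker_claimed ps = fst ` set ps"

definition breaker_claimed :: "'a round list \<Rightarrow> 'a set" where
  "breaker_claimed ps = \<Union> (snd ` set ps)"

definition unclaimed :: "'a set \<Rightarrow> 'a round list \<Rightarrow> 'a set" where
  "unclaimed B ps = B - (maker_claimed ps \<union> breaker_claimed ps)"

(* ps is a possibly unfinished (1:b) play on the finite board B.  "Up to b" includes that
   Breaker may claim nothing. *)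
definition legal_stage :: "nat \<Rightarrow> 'a set \<Rightarrow> 'a round list \<Rightarrow> bool" where
  "legal_stage b B ps \<longleftrightarrow>
     (\<forall>i < length ps.
        fst (ps ! i) \<in> unclaimed B (take i ps) \<and>
        snd (ps ! i) \<subseteq> unclaimed B (take i ps) - {fst (ps ! i)} \<and>
        card (snd (ps ! i)) \<le> b)"

definition finished_stage :: "nat \<Rightarrow> 'a set \<Rightarrow> 'a round list \<Rightarrow> bool" where
  "finished_stage b B ps \<longleftrightarrow> legal_stage b B ps \<and> unclaimed B ps = {}"

(* The board remaining after the finished stages pss of a game started on X:
   X itself if no stage has been played, otherwise Maker's elements of the last stage. *)
definition board :: "'a set \<Rightarrow> 'a round list list \<Rightarrow> 'a set" where
  "board X pss = (if pss = [] then X else maker_claimed (last pss))"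

definition legal_game :: "nat \<Rightarrow> 'a set \<Rightarrow> 'a round list list \<Rightarrow> bool" where
  "legal_game b X pss \<longleftrightarrow>
     (\<forall>j < length pss. finished_stage b (board X (take j pss)) (pss ! j))"

(* A strategy maps the history, i.e. the finished stages and the rounds played so far in the
   current stage, to the element Maker claims next. *)
type_synonym 'a strategy = "'a round list list \<Rightarrow> 'a round list \<Rightarrow> 'a"

definition maker_strategy :: "nat \<Rightarrow> 'a set \<Rightarrow> 'a strategy \<Rightarrow> bool" where
  "maker_strategy b X \<sigma> \<longleftrightarrow>
     (\<forall>pss ps. legal_game b X pss \<longrightarrow> legal_stage b (board X pss) ps \<longrightarrow>
        unclaimed (board X pss) ps \<noteq> {} \<longrightarrow>
        \<sigma> pss ps \<in> unclaimed (board X pss) ps)"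

definition follows :: "'a strategy \<Rightarrow> 'a round list list \<Rightarrow> bool" where
  "follows \<sigma> pss \<longleftrightarrow>
     (\<forall>j < length pss. \<forall>i < length (pss ! j).
        fst (pss ! j ! i) = \<sigma> (take j pss) (take i (pss ! j)))"

(* Maker can force that the board X_t left after t stages satisfies P.  On a finite board every
   stage ends, since Maker claims an element in each round, so every game in which Maker
   follows a legal strategy does reach the end of stage t. *)
definition maker_can_ensure :: "nat \<Rightarrow> 'a set \<Rightarrow> nat \<Rightarrow> ('a set \<Rightarrow> bool) \<Rightarrow> bool" where
  "maker_can_ensure b X t P \<longleftrightarrow>
     (\<exists>\<sigma>. maker_strategy b X \<sigma> \<and>
        (\<forall>pss. legal_game b X pss \<and> length pss = t \<and> follows \<sigma> pss \<longrightarrow> P (board X pss)))"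

end

theory Submission
  imports Defs "HOL-Analysis.Convex"
begin

text \<open>
  Maker plays every stage with the same potential function. A set \<open>A\<close> has weight
  \<open>exp (- L A)\<close> initially, each of its elements claimed by Maker multiplies the weight by
  \<open>1 - \<mu> A\<close>, and \<open>b\<close> of its elements claimed by Breaker multiply it by \<open>1 + \<mu> A\<close>. If Maker always
  claims the element of largest danger, the total weight never increases and hence stays at most 1,
  so that Maker obtains at least a fraction \<open>(1 - 4 * \<mu> A) / (b + 1)\<close> of what is left of \<open>A\<close>,
  as long as this remainder is large compared to \<open>b * L A / (\<mu> A)\<^sup>2\<close>. For \<open>A\<close> in \<open>Fs j\<close> take
  \<open>L A = ln (s * card (Fs j))\<close> and \<open>\<mu> A\<close> of the order of the inverse of the number of stages, so that
  the factors \<open>1 - 4 * \<mu> A\<close> cost only a constant in total.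
\<close>

section \<open>Plays of a single stage\<close>

lemma legal_stage_snoc:
  "legal_stage b B (ps @ [p]) \<longleftrightarrow> legal_stage b B ps \<and> fst p \<in> unclaimed B ps \<and>
     snd p \<subseteq> unclaimed B ps - {fst p} \<and> card (snd p) \<le> b"
  unfolding legal_stage_def by (auto simp: less_Suc_eq nth_append)

lemma maker_claimed_snoc: "maker_claimed (ps @ [p]) = insert (fst p) (maker_claimed ps)"
  and breaker_claimed_snoc: "breaker_claimed (ps @ [p]) = breaker_claimed ps \<union> snd p"
  by (auto simp: maker_claimed_def breaker_claimed_def)

lemma legal_stage_claimed:
  assumes "legal_stage b B ps"
  shows "maker_claimed ps \<subseteq> B" "breaker_claimed ps \<subseteq> B"
    "maker_claimed ps \<inter> breaker_claimed ps = {}"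
proof -
  have "maker_claimed ps \<subseteq> B \<and> breaker_claimed ps \<subseteq> B \<and> maker_claimed ps \<inter> breaker_claimed ps = {}"
    using assms
  proof (induction ps rule: rev_induct)
    case Nil
    then show ?case by (simp add: maker_claimed_def breaker_claimed_def)
  next
    case (snoc p ps)
    then show ?case
      by (auto simp: legal_stage_snoc maker_claimed_snoc breaker_claimed_snoc unclaimed_def)
  qed
  then show "maker_claimed ps \<subseteq> B" "breaker_claimed ps \<subseteq> B"
    "maker_claimed ps \<inter> breaker_claimed ps = {}" by auto
qed

lemma finite_board: "finite X \<Longrightarrow> finite (board X pss)"
  by (simp add: board_def maker_claimed_def)

section \<open>Maker's potential strategy\<close>

definition weight ::
    "nat \<Rightarrow> ('a set \<Rightarrow> real) \<Rightarrow> ('a set \<Rightarrow> real) \<Rightarrow> 'a round list \<Rightarrow> 'a set \<Rightarrow> real" where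
  "weight b L \<mu> ps A = exp (- L A) * (1 - \<mu> A) ^ card (A \<inter> maker_claimed ps)
     * (1 + \<mu> A) powr (real (card (A \<inter> breaker_claimed ps)) / real b)"

text \<open>This is the amount by which the total weight drops when Maker claims an unclaimed
  \<open>x\<close>. To first order, \<open>1 / b\<close> times it is what Breaker gains by claiming
  \<open>x\<close>, so one quantity measures the value of \<open>x\<close> to both players.\<close>

definition danger ::
    "nat \<Rightarrow> 'a set set \<Rightarrow> ('a set \<Rightarrow> real) \<Rightarrow> ('a set \<Rightarrow> real) \<Rightarrow> 'a round list \<Rightarrow> 'a \<Rightarrow> real" where
  "danger b F L \<mu> ps x = (\<Sum>A\<in>F. weight b L \<mu> ps A * \<mu> A * of_bool (x \<in> A))"

text \<open>The sign turns a minimiser into a maximiser of the danger. The earlier stages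
  \<open>pss\<close> enter only through the board: the weights see only the rounds
  \<open>ps\<close>, so the potential starts afresh in every stage.\<close>

definition danger_strategy ::
    "nat \<Rightarrow> 'a set \<Rightarrow> 'a set set \<Rightarrow> ('a set \<Rightarrow> real) \<Rightarrow> ('a set \<Rightarrow> real) \<Rightarrow> 'a strategy" where
  "danger_strategy b X F L \<mu> pss ps =
     arg_min_on (\<lambda>x. - danger b F L \<mu> ps x) (unclaimed (board X pss) ps)"

lemma danger_strategy_in:
  assumes "finite X" "unclaimed (board X pss) ps \<noteq> {}"
  shows "danger_strategy b X F L \<mu> pss ps \<in> unclaimed (board X pss) ps"
  unfolding danger_strategy_def
  using assms by (intro arg_min_if_finite(1)) (auto simp: unclaimed_def finite_board)

lemma danger_strategy_max:
  assumes "finite X" "y \<in> unclaimed (board X pss) ps"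
  shows "danger b F L \<mu> ps y \<le> danger b F L \<mu> ps (danger_strategy b X F L \<mu> pss ps)"
proof -
  have "finite (unclaimed (board X pss) ps)"
    using assms(1) by (auto simp: unclaimed_def finite_board)
  from arg_min_least[OF this _ assms(2), of "\<lambda>x. - danger b F L \<mu> ps x"] assms(2)
  show ?thesis by (auto simp: danger_strategy_def)
qed

text \<open>Bernoulli's inequality for exponents in the unit interval: weighted AM-GM for the points
  \<open>1 + u\<close> and \<open>1\<close>.\<close>

lemma one_plus_powr_le:
  fixes u \<theta> :: real
  assumes "0 \<le> u" "0 \<le> \<theta>" "\<theta> \<le> 1"
  shows "(1 + u) powr \<theta> \<le> 1 + u * \<theta>"
  using Youngs_inequality_0[of \<theta> "1 - \<theta>" "1 + u" 1] assms by (simp add: algebra_simps)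

text \<open>The new factor is replaced by an expression that is linear in Breaker's elements, so
  that his gain can later be summed element by element. Bernoulli applies because Breaker takes at
  most \<open>b\<close> elements, which keeps the exponent at most 1.\<close>

lemma weight_snoc_le:
  assumes legal: "legal_stage b B (ps @ [p])"
    and "finite B" and b: "b \<ge> 1" and \<mu>: "0 \<le> \<mu> A" "\<mu> A \<le> 1"
  shows "weight b L \<mu> (ps @ [p]) A
     \<le> weight b L \<mu> ps A * (1 - \<mu> A * of_bool (fst p \<in> A) + \<mu> A * card (A \<inter> snd p) / b)"
proof -
  let ?y = "card (A \<inter> snd p)"
  have "legal_stage b B ps" and p: "fst p \<in> unclaimed B ps" "snd p \<subseteq> unclaimed B ps" "card (snd p) \<le> b"
    using legal by (auto simp: legal_stage_snoc)
  note cl = legal_stage_claimed[OF this(1)]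
  have fin: "finite (maker_claimed ps)" "finite (breaker_claimed ps)" "finite (snd p)"
    using cl p \<open>finite B\<close> by (auto simp: unclaimed_def dest: finite_subset)
  have m: "card (A \<inter> maker_claimed (ps @ [p])) =
      card (A \<inter> maker_claimed ps) + of_bool (fst p \<in> A)"
    using p fin by (auto simp: maker_claimed_snoc unclaimed_def Int_insert_right)
  have "A \<inter> breaker_claimed (ps @ [p]) = (A \<inter> breaker_claimed ps) \<union> (A \<inter> snd p)"
    by (auto simp: breaker_claimed_snoc)
  then have br: "card (A \<inter> breaker_claimed (ps @ [p])) = card (A \<inter> breaker_claimed ps) + ?y"
    using p fin by (auto simp: unclaimed_def intro!: card_Un_disjoint)
  have y: "?y \<le> b"
    using p(3) card_mono[of "snd p" "A \<inter> snd p"] fin by auto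
  have w0: "weight b L \<mu> ps A \<ge> 0"
    using \<mu> by (auto simp: weight_def)
  have pw: "(1 + \<mu> A) powr (?y / b) \<le> 1 + \<mu> A * (?y / b)"
    using y b \<mu> by (intro one_plus_powr_le) auto
  have "weight b L \<mu> (ps @ [p]) A =
      weight b L \<mu> ps A * ((1 - \<mu> A * of_bool (fst p \<in> A)) * (1 + \<mu> A) powr (?y / b))"
    by (auto simp: weight_def m br add_divide_distrib powr_add)
  also have "\<dots> \<le> weight b L \<mu> ps A * ((1 - \<mu> A * of_bool (fst p \<in> A)) * (1 + \<mu> A * (?y / b)))"
    using \<mu> pw w0 by (intro mult_left_mono) auto
  also have "\<dots> \<le> weight b L \<mu> ps A * (1 - \<mu> A * of_bool (fst p \<in> A) + \<mu> A * ?y / b)"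
  proof (intro mult_left_mono w0)
    \<comment> \<open>The mixed term \<open>- a * z\<close> is not positive and is dropped.\<close>
    have "(1 - a) * (1 + z) \<le> 1 - a + z" if "0 \<le> a" "0 \<le> z" for a z :: real
      using that by (simp add: algebra_simps)
    from this[of "\<mu> A * of_bool (fst p \<in> A)" "\<mu> A * (?y / b)"]
    show "(1 - \<mu> A * of_bool (fst p \<in> A)) * (1 + \<mu> A * (?y / b))
        \<le> 1 - \<mu> A * of_bool (fst p \<in> A) + \<mu> A * ?y / b"
      using \<mu> by simp
  qed
  finally show ?thesis .
qed

text \<open>Exchanging the sums shows that Breaker gains at most \<open>1 / b\<close> times the
  total danger of his elements. These are at most \<open>b\<close> elements, all available when
  Maker chose, so each is at most as dangerous as hers. Hence her claim pays for his whole
  move.\<close>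

lemma potential_snoc_le:
  assumes legal: "legal_stage b B (ps @ [p])"
    and "finite B" and b: "b \<ge> 1"
    and \<mu>: "\<And>A. A \<in> F \<Longrightarrow> 0 \<le> \<mu> A" "\<And>A. A \<in> F \<Longrightarrow> \<mu> A \<le> 1"
    and max: "\<And>y. y \<in> unclaimed B ps \<Longrightarrow> danger b F L \<mu> ps y \<le> danger b F L \<mu> ps (fst p)"
  shows "(\<Sum>A\<in>F. weight b L \<mu> (ps @ [p]) A) \<le> (\<Sum>A\<in>F. weight b L \<mu> ps A)"
proof -
  let ?W = "weight b L \<mu> ps" and ?D = "danger b F L \<mu> ps"
  have p: "fst p \<in> unclaimed B ps" "snd p \<subseteq> unclaimed B ps" "card (snd p) \<le> b"
    using legal by (auto simp: legal_stage_snoc)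
  have fin: "finite (snd p)"
    using p \<open>finite B\<close> by (auto simp: unclaimed_def dest: finite_subset)
  have D0: "?D x \<ge> 0" for x
    using \<mu> by (auto simp: danger_def weight_def intro!: sum_nonneg)
  have "(\<Sum>A\<in>F. ?W A * \<mu> A * card (A \<inter> snd p)) = (\<Sum>A\<in>F. \<Sum>y\<in>snd p. ?W A * \<mu> A * of_bool (y \<in> A))"
    using fin by (simp add: sum_distrib_left[symmetric] of_bool_def sum.If_cases Int_commute)
  also have "\<dots> = (\<Sum>y\<in>snd p. ?D y)"
    by (subst sum.swap) (simp add: danger_def)
  also have "\<dots> \<le> card (snd p) * ?D (fst p)"
    using p max by (intro sum_bounded_above) auto
  also have "\<dots> \<le> b * ?D (fst p)"
    using p(3) D0 by (intro mult_right_mono) auto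
  finally have D: "(\<Sum>A\<in>F. ?W A * \<mu> A * card (A \<inter> snd p)) / b \<le> ?D (fst p)"
    using b by (simp add: field_simps)
  have "(\<Sum>A\<in>F. weight b L \<mu> (ps @ [p]) A)
      \<le> (\<Sum>A\<in>F. ?W A * (1 - \<mu> A * of_bool (fst p \<in> A) + \<mu> A * card (A \<inter> snd p) / b))"
    using \<mu> by (intro sum_mono weight_snoc_le[OF legal \<open>finite B\<close> b]) auto
  also have "\<dots> = (\<Sum>A\<in>F. ?W A) - ?D (fst p) + (\<Sum>A\<in>F. ?W A * \<mu> A * card (A \<inter> snd p)) / b"
    by (simp add: danger_def sum.distrib sum_subtractf sum_divide_distrib algebra_simps)
  finally show ?thesis using D by linarith
qed

lemma potential_le:
  assumes "legal_stage b B ps" "finite B" "b \<ge> 1"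
    and "\<And>A. A \<in> F \<Longrightarrow> 0 \<le> \<mu> A" "\<And>A. A \<in> F \<Longrightarrow> \<mu> A \<le> 1"
    and "\<And>i y. i < length ps \<Longrightarrow> y \<in> unclaimed B (take i ps) \<Longrightarrow>
           danger b F L \<mu> (take i ps) y \<le> danger b F L \<mu> (take i ps) (fst (ps ! i))"
  shows "(\<Sum>A\<in>F. weight b L \<mu> ps A) \<le> (\<Sum>A\<in>F. exp (- L A))"
  using assms(1,6)
proof (induction ps rule: rev_induct)
  case Nil
  \<comment> \<open>Only an inequality, as this is for every \<open>A\<close>: if
    \<open>1 + \<mu> A = 0\<close>, then its \<open>powr\<close> with exponent 0 is 0, not
    1.\<close>
  have "weight b L \<mu> [] A \<le> exp (- L A)" for A
    by (simp add: weight_def maker_claimed_def breaker_claimed_def powr_def)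
  then show ?case by (intro sum_mono)
next
  case (snoc p ps)
  have "danger b F L \<mu> (take i ps) y \<le> danger b F L \<mu> (take i ps) (fst (ps ! i))"
    if "i < length ps" "y \<in> unclaimed B (take i ps)" for i y
    using snoc.prems(2)[of i y] that by (simp add: nth_append)
  with snoc.IH snoc.prems(1) have "(\<Sum>A\<in>F. weight b L \<mu> ps A) \<le> (\<Sum>A\<in>F. exp (- L A))"
    by (auto simp: legal_stage_snoc)
  moreover have "(\<Sum>A\<in>F. weight b L \<mu> (ps @ [p]) A) \<le> (\<Sum>A\<in>F. weight b L \<mu> ps A)"
    using snoc.prems(2)[of "length ps"] assms
    by (intro potential_snoc_le[OF snoc.prems(1)]) auto
  ultimately show ?case by linarith
qed

text \<open>Taking logarithms in \<open>bal\<close> and expanding to second order bounds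
  \<open>R\<close> by \<open>b * M\<close> up to a relative error of order \<open>\<mu>\<close> and
  the term \<open>b * l / \<mu>\<close>. By \<open>large\<close>, that term is at most
  \<open>(M + R) * \<mu> / 2\<close>, again an error of order \<open>\<mu>\<close>.\<close>

lemma maker_share_ge:
  fixes \<mu> l :: real and b M R :: nat
  assumes b: "b \<ge> 1" and \<mu>: "0 < \<mu>" "\<mu> \<le> 1 / 10"
    and bal: "exp (- l) * (1 - \<mu>) ^ M * (1 + \<mu>) powr (real R / real b) \<le> 1"
    and large: "b * l \<le> real (M + R) * \<mu>\<^sup>2 / 2"
  shows "real (M + R) * ((1 - 4 * \<mu>) / (real b + 1)) \<le> real M"
proof -
  have "ln (exp (- l) * (1 - \<mu>) ^ M * (1 + \<mu>) powr (real R / real b)) \<le> 0"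
    using bal \<mu> by (subst ln_le_zero_iff) auto
  then have "R / b * ln (1 + \<mu>) \<le> l + M * (- ln (1 - \<mu>))"
    using \<mu> by (simp add: ln_mult ln_realpow ln_powr)
  moreover have "\<mu> - \<mu>\<^sup>2 \<le> ln (1 + \<mu>)"
    using ln_one_plus_pos_lower_bound[of \<mu>] \<mu> by simp
  moreover have "- ln (1 - \<mu>) \<le> \<mu> + 2 * \<mu>\<^sup>2"
    using ln_one_minus_pos_lower_bound[of \<mu>] \<mu> by simp
  ultimately have "R / b * (\<mu> - \<mu>\<^sup>2) \<le> l + M * (\<mu> + 2 * \<mu>\<^sup>2)"
    by (smt (verit) mult_left_mono of_nat_0_le_iff divide_nonneg_nonneg)
  then have *: "R * (\<mu> - \<mu>\<^sup>2) \<le> b * l + b * M * (\<mu> + 2 * \<mu>\<^sup>2)"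
    using b by (simp add: field_simps)
  have "\<mu> * (R * (1 - \<mu>)) \<le> \<mu> * ((M + R) * \<mu> / 2 + b * M * (1 + 2 * \<mu>))"
  proof -
    have "\<mu> * (R * (1 - \<mu>)) = R * (\<mu> - \<mu>\<^sup>2)"
      by (simp add: power2_eq_square algebra_simps)
    also have "\<dots> \<le> (M + R) * \<mu>\<^sup>2 / 2 + b * M * (\<mu> + 2 * \<mu>\<^sup>2)"
      using large * by linarith
    also have "\<dots> = \<mu> * ((M + R) * \<mu> / 2 + b * M * (1 + 2 * \<mu>))"
      by (simp add: power2_eq_square field_simps)
    finally show ?thesis .
  qed
  then have R: "R * (1 - \<mu>) \<le> (M + R) * \<mu> / 2 + b * M * (1 + 2 * \<mu>)"
    using \<mu> by (simp only: mult_le_cancel_left_pos)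
  \<comment> \<open>The factor \<open>1 + 2 * \<mu>\<close> matches the coefficient of
    \<open>b * M\<close> in \<open>R\<close>. The target coefficient
    \<open>1 - 3 * \<mu> / 2\<close> collects the loss \<open>\<mu>\<close> in
    \<open>R * (1 - \<mu>)\<close> and the loss \<open>\<mu> / 2\<close> coming from
    \<open>large\<close>.\<close>
  have "(1 + 2 * \<mu>) * (real (M + R) * (1 - 4 * \<mu>)) = (M + R) * (1 - 2 * \<mu> - 8 * \<mu>\<^sup>2)"
    by (simp add: power2_eq_square algebra_simps)
  also have "\<dots> \<le> (M + R) * (1 - 3 * \<mu> / 2)"
  proof (intro mult_left_mono)
    show "1 - 2 * \<mu> - 8 * \<mu>\<^sup>2 \<le> 1 - 3 * \<mu> / 2"
      using \<mu> zero_le_power2[of \<mu>] by linarith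
  qed simp
  also have "\<dots> = R * (1 - \<mu>) + M * (1 - \<mu>) - (M + R) * \<mu> / 2"
    by (simp add: algebra_simps)
  also have "\<dots> \<le> b * M * (1 + 2 * \<mu>) + M * (1 - \<mu>)"
    using R by linarith
  also have "\<dots> \<le> b * M * (1 + 2 * \<mu>) + M * (1 + 2 * \<mu>)"
    using \<mu> by (intro add_left_mono mult_left_mono) auto
  also have "\<dots> = (1 + 2 * \<mu>) * (M * (b + 1))"
    by (simp add: algebra_simps)
  finally have "real (M + R) * (1 - 4 * \<mu>) \<le> M * (b + 1)"
    using \<mu> by (subst (asm) mult_le_cancel_left_pos) auto
  then show ?thesis
    unfolding times_divide_eq_right by (subst pos_divide_le_eq) (auto simp: algebra_simps)
qed

section \<open>Several stages\<close>

text \<open>The total weight starts at most 1 and never grows. All weights are nonnegative, so each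
  single one is at most 1 at the end of the stage. Then everything in \<open>A\<close> on the board
  is Maker's or Breaker's, and \<open>maker_share_ge\<close> applies with these two counts.\<close>

lemma stage_board_ge:
  fixes \<mu> L :: "'a set \<Rightarrow> real"
  assumes game: "legal_game b X pss" and fol: "follows (danger_strategy b X F L \<mu>) pss"
    and i: "i < length pss"
    and X: "finite X" "finite F" "b \<ge> 1"
    and \<mu>: "\<And>A. A \<in> F \<Longrightarrow> 0 < \<mu> A" "\<And>A. A \<in> F \<Longrightarrow> \<mu> A \<le> 1 / 10"
    and L: "(\<Sum>A\<in>F. exp (- L A)) \<le> 1"
    and A: "A \<in> F" and large: "b * L A \<le> card (A \<inter> board X (take i pss)) * (\<mu> A)\<^sup>2 / 2"
  shows "card (A \<inter> board X (take i pss)) * ((1 - 4 * \<mu> A) / (real b + 1))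
     \<le> card (A \<inter> board X (take (Suc i) pss))"
proof -
  let ?B = "board X (take i pss)" and ?ps = "pss ! i"
  have fin: "finished_stage b ?B ?ps"
    using game i by (auto simp: legal_game_def)
  then have legal: "legal_stage b ?B ?ps" by (simp add: finished_stage_def)
  note cl = legal_stage_claimed[OF this]
  have B: "?B = maker_claimed ?ps \<union> breaker_claimed ?ps"
    using fin cl by (auto simp: finished_stage_def unclaimed_def)
  have "finite ?B" using X by (simp add: finite_board)
  have new: "board X (take (Suc i) pss) = maker_claimed ?ps"
    using i by (simp add: board_def take_Suc_conv_app_nth)
  have "A \<inter> ?B = (A \<inter> maker_claimed ?ps) \<union> (A \<inter> breaker_claimed ?ps)"
    using B by auto
  then have card: "card (A \<inter> ?B) = card (A \<inter> maker_claimed ?ps) + card (A \<inter> breaker_claimed ?ps)"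
    using cl \<open>finite ?B\<close> by (auto intro!: card_Un_disjoint dest: finite_subset)
  have "(\<Sum>A\<in>F. weight b L \<mu> ?ps A) \<le> (\<Sum>A\<in>F. exp (- L A))"
  proof (rule potential_le[OF legal \<open>finite ?B\<close> \<open>b \<ge> 1\<close>])
    fix l y assume l: "l < length ?ps" and y: "y \<in> unclaimed ?B (take l ?ps)"
    have "fst (?ps ! l) = danger_strategy b X F L \<mu> (take i pss) (take l ?ps)"
      using fol i l by (auto simp: follows_def)
    then show "danger b F L \<mu> (take l ?ps) y \<le> danger b F L \<mu> (take l ?ps) (fst (?ps ! l))"
      using danger_strategy_max[OF X(1) y] by simp
  next
    fix A assume "A \<in> F"
    then show "0 \<le> \<mu> A" "\<mu> A \<le> 1" using \<mu>[of A] by auto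
  qed
  with L have "(\<Sum>A\<in>F. weight b L \<mu> ?ps A) \<le> 1" by linarith
  moreover have "weight b L \<mu> ?ps A \<le> (\<Sum>A\<in>F. weight b L \<mu> ?ps A)"
  proof (rule member_le_sum[OF A _ X(2)])
    fix C assume "C \<in> F - {A}"
    then show "0 \<le> weight b L \<mu> ?ps C" using \<mu>[of C] by (auto simp: weight_def)
  qed
  ultimately have "weight b L \<mu> ?ps A \<le> 1" by linarith
  then show ?thesis
    using maker_share_ge[OF X(3) \<mu>(1)[OF A] \<mu>(2)[OF A]] large
    by (simp add: card new weight_def)
qed

lemma maker_can_ensure_share:
  fixes \<mu> L :: "'a set \<Rightarrow> real"
  assumes X: "finite X" "F \<subseteq> Pow X" "b \<ge> 1"
    and \<mu>: "\<And>A. A \<in> F \<Longrightarrow> 0 < \<mu> A" "\<And>A. A \<in> F \<Longrightarrow> \<mu> A \<le> 1 / 10"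
    and L: "(\<Sum>A\<in>F. exp (- L A)) \<le> 1"
    and large: "\<And>A. A \<in> F \<Longrightarrow>
      b * L A \<le> card A * ((1 - 4 * \<mu> A) / (real b + 1)) ^ t * (\<mu> A)\<^sup>2 / 2"
  shows "maker_can_ensure b X t
     (\<lambda>B. \<forall>A\<in>F. card A * ((1 - 4 * \<mu> A) / (real b + 1)) ^ t \<le> card (A \<inter> B))"
  unfolding maker_can_ensure_def
proof (intro exI conjI allI impI)
  show "maker_strategy b X (danger_strategy b X F L \<mu>)"
    unfolding maker_strategy_def using danger_strategy_in[OF X(1)] by blast
next
  fix pss
  assume *: "legal_game b X pss \<and> length pss = t \<and> follows (danger_strategy b X F L \<mu>) pss"
  have "finite F" using X by (auto intro: finite_subset)
  show "\<forall>A\<in>F. card A * ((1 - 4 * \<mu> A) / (real b + 1)) ^ t \<le> card (A \<inter> board X pss)"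
  proof
    fix A assume A: "A \<in> F"
    let ?q = "(1 - 4 * \<mu> A) / (real b + 1)"
    have q: "0 \<le> ?q" "?q \<le> 1" using \<mu>[OF A] by (auto simp: field_simps)
    have "card A * ?q ^ i \<le> card (A \<inter> board X (take i pss))" if "i \<le> t" for i
      using that
    proof (induction i)
      case 0
      have "A \<inter> X = A" using A X by auto
      then show ?case by (simp add: board_def)
    next
      case (Suc i)
      then have IH: "card A * ?q ^ i \<le> card (A \<inter> board X (take i pss))" by simp
      \<comment> \<open>\<open>large\<close> is assumed only for the size guaranteed after all
        \<open>t\<close> stages. Because \<open>?q\<close> is at most 1, this is the smallest of the
        guaranteed sizes, so the condition holds in every stage.\<close>
      have "?q ^ t \<le> ?q ^ i" using Suc.prems q by (intro power_decreasing) auto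
      then have "card A * ?q ^ t \<le> card (A \<inter> board X (take i pss))"
        using IH by (meson mult_left_mono of_nat_0_le_iff order_trans)
      then have "card A * ?q ^ t * (\<mu> A)\<^sup>2 / 2 \<le> card (A \<inter> board X (take i pss)) * (\<mu> A)\<^sup>2 / 2"
        by (intro divide_right_mono mult_right_mono) auto
      then have "b * L A \<le> card (A \<inter> board X (take i pss)) * (\<mu> A)\<^sup>2 / 2"
        using large[OF A] by linarith
      then have "card (A \<inter> board X (take i pss)) * ?q \<le> card (A \<inter> board X (take (Suc i) pss))"
        using * Suc.prems by (intro stage_board_ge[OF _ _ _ X(1) \<open>finite F\<close> X(3) \<mu> L A]) auto
      moreover have "card A * ?q ^ i * ?q \<le> card (A \<inter> board X (take i pss)) * ?q"
        using IH q by (intro mult_right_mono) auto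
      ultimately show ?case by (simp add: mult_ac)
    qed
    from this[of t] show "card A * ?q ^ t \<le> card (A \<inter> board X pss)"
      using * by simp
  qed
qed

lemma maker_can_ensure_mono:
  assumes "maker_can_ensure b X t P" and "\<And>B. P B \<Longrightarrow> Q B"
  shows "maker_can_ensure b X t Q"
  using assms unfolding maker_can_ensure_def by blast

section \<open>The choice of parameters\<close>

text \<open>Split \<open>r\<close> into \<open>r powr (1 - \<gamma>)\<close> and
  \<open>r powr \<gamma>\<close>. The first part pays for the factor \<open>(b + 1) ^ t\<close> lost
  in \<open>t\<close> stages. The second is at least \<open>400 * b\<^sup>2 * T\<^sup>2\<close> by
  the squared assumption \<open>r\<close>, which outweighs \<open>1 / \<mu>\<^sup>2\<close> and the
  remaining constants.\<close>

lemma remaining_share_large: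
  fixes r l \<gamma> \<mu> c :: real and b t :: nat
  assumes "0 < r" "0 < l" "b \<ge> 1" "0 < \<gamma>" "\<gamma> < 1"
    and c: "r * l \<le> c"
    and r: "20 * b * max 1 (log (real (b + 1)) r) \<le> r powr (\<gamma> / 2)"
    and \<mu>: "\<mu> = 1 / (10 * max 1 (log (real (b + 1)) r))"
    and t: "t \<le> (1 - \<gamma>) * log (real (b + 1)) r"
  shows "b * l \<le> c * ((1 - 4 * \<mu>) / (real b + 1)) ^ t * \<mu>\<^sup>2 / 2"
proof -
  define T where "T = max 1 (log (real (b + 1)) r)"
  have T: "1 \<le> T" "log (real (b + 1)) r \<le> T" by (auto simp: T_def)
  have "\<mu> = 1 / (10 * T)" using \<mu> by (simp add: T_def)
  then have \<mu>T: "\<mu> = 1 / (10 * T)" "\<mu> * T = 1 / 10" "0 < \<mu>" "\<mu> \<le> 1 / 10"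
    using T(1) by (simp_all add: pos_divide_le_eq)
  \<comment> \<open>A natural number \<open>t\<close> lies below this product, so the logarithm
    cannot be negative.\<close>
  have "0 \<le> (1 - \<gamma>) * log (real (b + 1)) r" using t by linarith
  then have "0 \<le> log (real (b + 1)) r" using \<open>\<gamma> < 1\<close> by (simp add: zero_le_mult_iff)
  then have "(1 - \<gamma>) * log (real (b + 1)) r \<le> 1 * log (real (b + 1)) r"
    using \<open>0 < \<gamma>\<close> by (intro mult_right_mono) auto
  then have "t \<le> T" using t T by linarith
  then have "\<mu> * t \<le> 1 / 10" using \<mu>T by (metis mult_left_mono less_imp_le)
  \<comment> \<open>By Bernoulli's inequality all factors \<open>1 - 4 * \<mu>\<close> together cost
    at most \<open>4 * (\<mu> * t)\<close>, which is at most \<open>4 / 10\<close>.\<close>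
  then have half: "1 / 2 \<le> (1 - 4 * \<mu>) ^ t"
  proof -
    have "1 + t * (- 4 * \<mu>) \<le> (1 + - 4 * \<mu>) ^ t"
      using \<mu>T(4) by (intro Bernoulli_inequality) simp
    then have "1 - 4 * (\<mu> * t) \<le> (1 - 4 * \<mu>) ^ t" by (simp add: mult_ac)
    then show ?thesis using \<open>\<mu> * t \<le> 1 / 10\<close> by linarith
  qed
  have "(real (b + 1)) ^ t = (real (b + 1)) powr t"
    by (simp add: powr_realpow)
  also have "\<dots> \<le> (real (b + 1)) powr (log (real (b + 1)) r * (1 - \<gamma>))"
    using t by (intro powr_mono) (auto simp: mult.commute)
  also have "\<dots> = r powr (1 - \<gamma>)"
    using \<open>0 < r\<close> \<open>b \<ge> 1\<close> by (simp add: powr_powr[symmetric] del: of_nat_Suc of_nat_add)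
  finally have pow: "(real (b + 1)) ^ t \<le> r powr (1 - \<gamma>)" .
  have "(20 * b * T)\<^sup>2 \<le> (r powr (\<gamma> / 2))\<^sup>2"
    using r T by (intro power_mono) (auto simp: T_def)
  also have "\<dots> = r powr \<gamma>"
    by (simp add: power2_eq_square powr_add[symmetric])
  finally have rg: "400 * (real b)\<^sup>2 * T\<^sup>2 \<le> r powr \<gamma>" by (simp add: power_mult_distrib)
  have rr: "r = r powr \<gamma> * r powr (1 - \<gamma>)"
    using \<open>0 < r\<close> by (simp add: powr_add[symmetric])
  have "real b * 1 \<le> real b * real b" using \<open>b \<ge> 1\<close> by (intro mult_left_mono) auto
  then have "b * l \<le> (real b)\<^sup>2 * l"
    unfolding power2_eq_square using \<open>0 < l\<close> by (intro mult_right_mono) auto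
  \<comment> \<open>Here \<open>400 = 100 * 2 * 2\<close>:
    \<open>1 / \<mu>\<^sup>2 = 100 * T\<^sup>2\<close>, one 2 compensates the bound
    \<open>half\<close>, the other the final division by 2.\<close>
  also have "\<dots> = 400 * (real b)\<^sup>2 * T\<^sup>2 * l * (1 / 2) * \<mu>\<^sup>2 / 2"
    using T by (simp add: \<mu>T(1) power2_eq_square field_simps)
  also have "\<dots> \<le> r powr \<gamma> * l * (1 / 2) * \<mu>\<^sup>2 / 2"
    using rg \<open>0 < l\<close> by (intro divide_right_mono mult_right_mono) auto
  also have "\<dots> \<le> (c / (real (b + 1)) ^ t) * (1 - 4 * \<mu>) ^ t * \<mu>\<^sup>2 / 2"
  proof (intro divide_right_mono mult_right_mono mult_mono half)
    have "r powr \<gamma> * l * (real (b + 1)) ^ t \<le> r powr \<gamma> * l * r powr (1 - \<gamma>)"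
      using pow \<open>0 < l\<close> by (intro mult_left_mono) auto
    also have "\<dots> = r * l" by (subst (3) rr) simp
    finally show "r powr \<gamma> * l \<le> c / (real (b + 1)) ^ t"
      using c by (simp add: pos_le_divide_eq del: of_nat_Suc of_nat_add)
    have "0 \<le> c" using c \<open>0 < r\<close> \<open>0 < l\<close> by (meson mult_pos_pos less_imp_le order_trans)
    then show "0 \<le> c / (real (b + 1)) ^ t" by simp
  qed auto
  finally show ?thesis by (simp add: power_divide add.commute)
qed

theorem lemma2p4:
  fixes X :: "'a set" and F :: "'a set set" and Fs :: "nat \<Rightarrow> 'a set set"
    and n b s :: nat and k :: "nat \<Rightarrow> nat" and \<gamma> :: real
  assumes "hypergraph X F" and "card X = n"
    and "0 < \<gamma>" and "\<gamma> < 1"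
    and "b \<ge> 1" and "s \<ge> 1"
    and "F = (\<Union>j\<in>{1..s}. Fs j)"
    and "\<And>j. j \<in> {1..s} \<Longrightarrow> Fs j \<noteq> {}"
    and "card F > 1"
    and "\<And>j. j \<in> {1..s} \<Longrightarrow> k j = Min (card ` Fs j)"
    and "\<And>j. j \<in> {1..s} \<Longrightarrow>
           (real (k j) / ln (real (s * card (Fs j)))) powr (\<gamma> / 2)
             \<ge> 20 * real b * max 1 (log (real (b + 1)) (real (k j) / ln (real (s * card (Fs j)))))"
  shows "maker_can_ensure b X
           (nat \<lfloor>(1 - \<gamma>) *
              Min ((\<lambda>i. log (real (b + 1)) (real (k i) / ln (real (s * card (Fs i))))) ` {1..s})\<rfloor>)
           (\<lambda>X\<^sub>t. \<forall>A\<in>F. A \<inter> X\<^sub>t \<noteq> {})"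
proof -
  define r where "r i = real (k i) / ln (real (s * card (Fs i)))" for i
  define l where "l i = ln (real (s * card (Fs i)))" for i
  define t where "t = nat \<lfloor>(1 - \<gamma>) * Min ((\<lambda>i. log (real (b + 1)) (r i)) ` {1..s})\<rfloor>"
  have finX: "finite X" and FX: "F \<subseteq> Pow X"
    using assms(1) by (auto simp: hypergraph_def)
  have finF: "finite F" using finX FX by (auto intro: finite_subset)
  have Fs: "Fs j \<subseteq> F" "finite (Fs j)" "card (Fs j) \<ge> 1" if "j \<in> {1..s}" for j
  proof -
    show "Fs j \<subseteq> F" using that assms(7) by auto
    then show fin: "finite (Fs j)" using finF by (rule finite_subset)
    then show "card (Fs j) \<ge> 1"
      using assms(8)[OF that] by (simp add: Suc_le_eq card_gt_0_iff)
  qed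
  \<comment> \<open>This makes the logarithms positive. For \<open>s = 1\<close> the only family is
    \<open>F\<close> itself, which has more than one member; otherwise the factor \<open>s\<close>
    suffices.\<close>
  have two: "s * card (Fs j) \<ge> 2" if "j \<in> {1..s}" for j
  proof (cases "s = 1")
    case True
    then have "Fs j = F" using that assms(7) by auto
    then show ?thesis using True assms(9) by simp
  next
    case False
    then have "2 * 1 \<le> s * card (Fs j)"
      using assms(6) Fs(3)[OF that] by (intro mult_le_mono) auto
    then show ?thesis by simp
  qed
  have l: "0 < l j" if "j \<in> {1..s}" for j
    using two[OF that] unfolding l_def by (intro ln_gt_zero) linarith
  have big: "20 * b * max 1 (log (real (b + 1)) (r j)) \<le> r j powr (\<gamma> / 2)" if "j \<in> {1..s}" for j
    using assms(11)[OF that] by (simp add: r_def)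
  \<comment> \<open>If \<open>r j\<close> were below 1, its power would be at most 1, whereas the
    assumption makes it at least 20.\<close>
  have r: "1 \<le> r j" if "j \<in> {1..s}" for j
  proof (rule ccontr)
    assume "\<not> 1 \<le> r j"
    moreover have "0 \<le> r j" using l[OF that] by (simp add: r_def l_def)
    ultimately have "r j powr (\<gamma> / 2) \<le> 1"
      using assms(3) by (intro powr_le1) auto
    moreover have "20 * 1 * 1 \<le> 20 * b * max 1 (log (real (b + 1)) (r j))"
      using assms(5) by (intro mult_mono) auto
    ultimately show False using big[OF that] by linarith
  qed
  have t: "t \<le> (1 - \<gamma>) * log (real (b + 1)) (r j)" if "j \<in> {1..s}" for j
  proof -
    let ?m = "Min ((\<lambda>i. log (real (b + 1)) (r i)) ` {1..s})"
    have "?m \<in> (\<lambda>i. log (real (b + 1)) (r i)) ` {1..s}"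
      using assms(6) by (intro Min_in) auto
    then obtain i where "i \<in> {1..s}" "?m = log (real (b + 1)) (r i)" by blast
    \<comment> \<open>A negative value would be raised to 0 by \<open>nat\<close>, and
      \<open>t\<close> would then exceed the bound.\<close>
    then have "0 \<le> ?m" using r[of i] assms(5) by (simp del: Min_ge_iff)
    then have "t \<le> (1 - \<gamma>) * ?m" unfolding t_def using assms(4) by (intro of_nat_floor) simp
    also have "\<dots> \<le> (1 - \<gamma>) * log (real (b + 1)) (r j)"
      using that assms(4) by (intro mult_left_mono Min_le) auto
    finally show ?thesis .
  qed
  \<comment> \<open>The families may overlap. Fixing one family for each set makes the parameters
    \<open>\<mu>\<close> and \<open>L\<close> functions of the set alone.\<close>
  define J where "J A = (SOME j. j \<in> {1..s} \<and> A \<in> Fs j)" for A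
  have J: "J A \<in> {1..s}" "A \<in> Fs (J A)" if "A \<in> F" for A
  proof -
    have "\<exists>j. j \<in> {1..s} \<and> A \<in> Fs j" using that assms(7) by auto
    from someI_ex[OF this] show "J A \<in> {1..s}" "A \<in> Fs (J A)" by (auto simp: J_def)
  qed
  define \<mu> where "\<mu> A = 1 / (10 * max 1 (log (real (b + 1)) (r (J A))))" for A
  define L where "L A = l (J A)" for A
  have \<mu>: "0 < \<mu> A" "\<mu> A \<le> 1 / 10" for A
    by (auto simp: \<mu>_def field_simps)
  \<comment> \<open>Each of the \<open>s\<close> families contributes at most
    \<open>card (Fs j)\<close> terms equal to \<open>1 / (s * card (Fs j))\<close>, hence at most
    \<open>1 / s\<close>. This is why \<open>s\<close> stands inside the logarithm.\<close>
  have L: "(\<Sum>A\<in>F. exp (- L A)) \<le> 1"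
  proof -
    have e: "exp (- l j) = 1 / (s * card (Fs j))" if "j \<in> {1..s}" for j
    proof -
      have "0 < real (s * card (Fs j))" using two[OF that] by linarith
      then show ?thesis by (simp add: l_def exp_minus inverse_eq_divide del: of_nat_mult)
    qed
    have "(\<Sum>A\<in>F. exp (- L A)) = (\<Sum>j\<in>{1..s}. \<Sum>A\<in>{A\<in>F. J A = j}. exp (- L A))"
      using J finF by (intro sum.group[symmetric]) auto
    also have "\<dots> \<le> (\<Sum>j\<in>{1..s}. \<Sum>A\<in>Fs j. exp (- l j))"
    proof (rule sum_mono)
      fix j assume j: "j \<in> {1..s}"
      have "(\<Sum>A\<in>{A\<in>F. J A = j}. exp (- L A)) = (\<Sum>A\<in>{A\<in>F. J A = j}. exp (- l j))"
        by (rule sum.cong) (auto simp: L_def)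
      also have "\<dots> \<le> (\<Sum>A\<in>Fs j. exp (- l j))"
        using Fs[OF j] J by (intro sum_mono2) auto
      finally show "(\<Sum>A\<in>{A\<in>F. J A = j}. exp (- L A)) \<le> (\<Sum>A\<in>Fs j. exp (- l j))" .
    qed
    also have "\<dots> = (\<Sum>j\<in>{1..s}. 1 / s)"
    proof (rule sum.cong[OF refl])
      fix j assume j: "j \<in> {1..s}"
      show "(\<Sum>A\<in>Fs j. exp (- l j)) = 1 / s" using Fs(3)[OF j] by (simp add: e[OF j])
    qed
    also have "\<dots> = 1" using assms(6) by simp
    finally show ?thesis .
  qed
  have large: "b * L A \<le> card A * ((1 - 4 * \<mu> A) / (real b + 1)) ^ t * (\<mu> A)\<^sup>2 / 2" if A: "A \<in> F" for A
  proof (rule remaining_share_large)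
    show "0 < r (J A)" using r[OF J(1)[OF A]] by simp
    have "k (J A) \<le> card A"
      using assms(10)[OF J(1)[OF A]] Fs(2)[OF J(1)[OF A]] J(2)[OF A] by simp
    then show "r (J A) * L A \<le> card A"
      using l[OF J(1)[OF A]] by (simp add: r_def L_def l_def)
  qed (use assms(3-5) l[OF J(1)[OF A]] big[OF J(1)[OF A]] t[OF J(1)[OF A]] in \<open>simp_all add: L_def \<mu>_def\<close>)
  have "maker_can_ensure b X t (\<lambda>B. \<forall>A\<in>F. card A * ((1 - 4 * \<mu> A) / (real b + 1)) ^ t \<le> card (A \<inter> B))"
    by (rule maker_can_ensure_share[OF finX FX assms(5) \<mu> L large])
  then have "maker_can_ensure b X t (\<lambda>B. \<forall>A\<in>F. A \<inter> B \<noteq> {})"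
  proof (rule maker_can_ensure_mono, intro ballI notI)
    fix B A
    assume *: "\<forall>A\<in>F. card A * ((1 - 4 * \<mu> A) / (real b + 1)) ^ t \<le> card (A \<inter> B)"
      and A: "A \<in> F" and "A \<inter> B = {}"
    \<comment> \<open>The guaranteed size is positive because \<open>large\<close> bounds a positive
      multiple of it from below by \<open>b * L A\<close>, which is positive.\<close>
    have "card A * ((1 - 4 * \<mu> A) / (real b + 1)) ^ t \<le> 0" using *[rule_format, OF A] \<open>A \<inter> B = {}\<close> by simp
    then have "card A * ((1 - 4 * \<mu> A) / (real b + 1)) ^ t * (\<mu> A)\<^sup>2 / 2 \<le> 0"
      by (simp add: mult_nonpos_nonneg)
    moreover have "0 < b * L A" using l J(1)[OF A] assms(5) by (simp add: L_def)
    ultimately show False using large[OF A] by linarith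
  qed
  then show ?thesis by (simp add: t_def r_def)
qed

end
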